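(* Let $q$ be a complex number with $|q|<1$, let $m\ge0$ be an integer, and let $x,y$ be complex numbers with $x\ne0$, $x\neq yq$, $(x;q)_m\ne0$ and $(q^2/x;q)_m\neq0$. Then $$\frac{(yq^2/x;q)_m}{(q^2/x;q)_m}\sum_{k=0}^m\begin{bmatrix}m+k\\k\end{bmatrix}_q\frac{(y;q)_k}{(x;q)_k}q^k=1+\frac{q+x}{x-yq}\sum_{k=1}^m\begin{bmatrix}2k-1\\k\end{bmatrix}_q\frac{(y;q)_k(yq/x;q)_k}{(x;q)_k(q^2/x;q)_k}q^k-\frac{yq}{x-yq}\sum_{k=1}^m\begin{bmatrix}2k\\k\end{bmatrix}_q\frac{(y;q)_k(yq/x;q)_k}{(x;q)_k(q^2/x;q)_k}q^{2k}.$$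
   Context: For integers $n\ge 0$, $(x;q)_n=\prod_{i=0}^{n-1}(1-xq^i)$ (empty product equal to $1$). The $q$-binomial coefficient is $\begin{bmatrix}n\\k\end{bmatrix}_q=\frac{(q;q)_n}{(q;q)_{n-k}(q;q)_k}$. *)

theory Defs
  imports Complex_Main
begin

definition q_pochhammer :: "'a :: comm_ring_1 \<Rightarrow> 'a \<Rightarrow> nat \<Rightarrow> 'a" where
  "q_pochhammer x q n = (\<Prod>i<n. 1 - x * q ^ i)"

(* Meaningful for k \<le> n only; for k > n the truncated subtraction n - k is 0, and the
   value is not the customary 0. *)
definition q_binomial :: "'a :: field \<Rightarrow> nat \<Rightarrow> nat \<Rightarrow> 'a" where
  "q_binomial q n k = q_pochhammer q q n / (q_pochhammer q q (n - k) * q_pochhammer q q k)"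

end

theory Submission
  imports Defs
begin

text \<open>
  Write \<open>F(m,k)\<close> for the \<open>k\<close>-th summand on the left, prefactor included. The difference
  \<open>F(m+1,k) - F(m,k)\<close> is Gosper-summable in \<open>k\<close>: it equals \<open>G(k+1) - G(k)\<close> for an explicit
  hypergeometric \<open>G\<close> with \<open>G(0) = 0\<close>. Hence the left-hand side grows by \<open>F(m+1,m+1) + G(m+1)\<close> when
  \<open>m\<close> increases by one, and this is exactly the \<open>(m+1)\<close>-st summand on the right.
\<close>

lemma q_pochhammer_0 [simp]: "q_pochhammer x q 0 = 1"
  by (simp add: q_pochhammer_def)

lemma q_pochhammer_Suc: "q_pochhammer x q (Suc n) = q_pochhammer x q n * (1 - x * q ^ n)"
  by (simp add: q_pochhammer_def)

lemma q_pochhammer_Suc_shift: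
  "q_pochhammer x q (Suc n) = (1 - x) * q_pochhammer (x * q) q n"
  unfolding q_pochhammer_def prod.lessThan_Suc_shift by (simp add: mult.assoc)

lemma q_pochhammer_self_nonzero:
  fixes q :: "'a :: field"
  assumes "\<And>k. q ^ Suc k \<noteq> 1"
  shows "q_pochhammer q q n \<noteq> 0"
  using assms by (simp add: q_pochhammer_def)

lemma q_binomial_0:
  fixes q :: "'a :: field"
  assumes "\<And>k. q ^ Suc k \<noteq> 1"
  shows "q_binomial q n 0 = 1"
  using q_pochhammer_self_nonzero[OF assms] by (simp add: q_binomial_def)

text \<open>With the upper entry written as \<open>n + k\<close>, the subtraction in
  \<open>q_binomial\<close> returns exactly \<open>n\<close>, so truncation never
  interferes.\<close>

lemma q_binomial_add_Suc_left:
  fixes q :: "'a :: field"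
  shows "q_binomial q (Suc n + k) k = q_binomial q (n + k) k * (1 - q ^ Suc (n + k)) / (1 - q ^ Suc n)"
  by (simp add: q_binomial_def q_pochhammer_Suc ac_simps)

lemma q_binomial_add_Suc_right:
  fixes q :: "'a :: field"
  shows "q_binomial q (n + Suc k) (Suc k) = q_binomial q (n + k) k * (1 - q ^ Suc (n + k)) / (1 - q ^ Suc k)"
  by (simp add: q_binomial_def q_pochhammer_Suc ac_simps)

text \<open>The relation F(n+1,k) - F(n,k) = G(k+1) - G(k) with \<open>a\<close> = q^n and
  \<open>b\<close> = q^k. Here \<open>B\<close> is the q-binomial, \<open>Z\<close> the quotient of
  Pochhammer symbols and \<open>P\<close> the prefactor at n. G(k+1) is already expressed through
  \<open>B\<close> and \<open>Z\<close> at k, so only a polynomial identity in \<open>a\<close>,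
  \<open>b\<close>, \<open>q\<close>, \<open>x\<close>, \<open>y\<close> remains once denominators
  are cleared.\<close>

lemma gosper_step:
  fixes q x y P B Z a b :: "'a :: field"
  assumes "x - q\<^sup>2 * a \<noteq> 0" "1 - q * a \<noteq> 0"
  shows "P * ((x - y * q\<^sup>2 * a) / (x - q\<^sup>2 * a)) * (B * (1 - q * a * b) / (1 - q * a) * Z * b)
      - P * (B * Z * b)
    = P * (q * a) / ((x - q\<^sup>2 * a) * (1 - q * a)) *
        (B * (1 - q * a * b) * (q * (1 - y * b)) * Z)
      - P * (q * a) / ((x - q\<^sup>2 * a) * (1 - q * a)) *
        (B * (1 - b) * (q - x * b) * Z)"
  using assms by (simp add: divide_simps) algebra

text \<open>
  In the certificate on the right, \<open>q - x * q ^ N\<close> stands for \<open>q * (1 - x * q ^ (N - 1))\<close>, so that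
  \<open>q = 0\<close> and \<open>N = 0\<close> need no separate treatment.
\<close>

lemma gosper_sum:
  fixes q x y P :: "'a :: field"
  assumes q: "\<And>k. q ^ Suc k \<noteq> 1"
    and x: "q_pochhammer x q N \<noteq> 0"
    and n: "x - q\<^sup>2 * q ^ n \<noteq> 0"
  shows "P * ((x - y * q\<^sup>2 * q ^ n) / (x - q\<^sup>2 * q ^ n)) *
        (\<Sum>k<N. q_binomial q (Suc n + k) k * (q_pochhammer y q k / q_pochhammer x q k) * q ^ k)
      - P * (\<Sum>k<N. q_binomial q (n + k) k * (q_pochhammer y q k / q_pochhammer x q k) * q ^ k)
    = P * (q * q ^ n) / ((x - q\<^sup>2 * q ^ n) * (1 - q * q ^ n)) *
        (q_binomial q (n + N) N * (1 - q ^ N) * (q - x * q ^ N)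
          * (q_pochhammer y q N / q_pochhammer x q N))"
  using x
proof (induction N)
  case 0
  then show ?case by simp
next
  case (Suc N)
  let ?Z = "q_pochhammer y q N / q_pochhammer x q N"
  let ?B = "q_binomial q (n + N) N"
  have nz: "q_pochhammer x q N \<noteq> 0" "1 - x * q ^ N \<noteq> 0"
    using Suc.prems by (auto simp: q_pochhammer_Suc)
  have qN: "1 - q * q ^ N \<noteq> 0" and qn: "1 - q * q ^ n \<noteq> 0"
    using q[of N] q[of n] by auto
  have B: "q_binomial q (n + Suc N) (Suc N) * (1 - q ^ Suc N) = ?B * (1 - q * q ^ n * q ^ N)"
    using qN by (simp add: q_binomial_add_Suc_right[simplified] power_add mult.assoc)
  have Z: "(q - x * q ^ Suc N) * (q_pochhammer y q (Suc N) / q_pochhammer x q (Suc N))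
      = q * (1 - y * q ^ N) * ?Z"
    using nz by (simp add: q_pochhammer_Suc divide_simps) (simp add: algebra_simps)
  \<comment> \<open>G(N+1) is brought back to the data at N: 1 - q^(N+1) cancels the new denominator
    of the q-binomial, and q - x q^(N+1) = q (1 - x q^N) cancels the new factor of
    (x;q)_(N+1).\<close>
  have cert: "q_binomial q (n + Suc N) (Suc N) * (1 - q ^ Suc N) * (q - x * q ^ Suc N)
        * (q_pochhammer y q (Suc N) / q_pochhammer x q (Suc N))
      = ?B * (1 - q * q ^ n * q ^ N) * (q * (1 - y * q ^ N)) * ?Z"
    unfolding B mult.assoc[of _ "q - x * q ^ Suc N"] Z by (simp only: mult.assoc)
  have B': "q_binomial q (Suc n + N) N = ?B * (1 - q * q ^ n * q ^ N) / (1 - q * q ^ n)"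
    using q_binomial_add_Suc_left[of q n N] by (simp add: power_add mult.assoc)
  have telescope: "a + b - (c + d) = e" if "a - c = f" "b - d = e - f" for a b c d e f :: 'a
    using that by (simp add: algebra_simps)
  note step = gosper_step[OF n qn, of P y ?B "q ^ N" ?Z]
  show ?case
    unfolding sum.lessThan_Suc distrib_left cert B'
    using Suc.IH[OF nz(1)] step by (rule telescope)
qed

text \<open>With \<open>a\<close> = q^m, the left side is F(m+1,m+1) + G(m+1) and the right side the
  summand at m+1. Dividing by the common factor P B Z q a / (x - q^2 a) leaves (x - y q^2 a)(1 + q
  a) + (q - x q a) = (q + x) - y q (1 + q a) q a, where the terms x q a cancel.\<close>

lemma summand_step:
  fixes q x y P B Z a :: "'a :: field"
  assumes "x - y * q \<noteq> 0" "x - q\<^sup>2 * a \<noteq> 0" "1 - q * a \<noteq> 0"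
  shows "P * ((x - y * q\<^sup>2 * a) / (x - q\<^sup>2 * a)) * (B * (1 + q * a) * Z * (q * a))
      + P * (q * a) / ((x - q\<^sup>2 * a) * (1 - q * a)) * (B * (1 - q * a) * (q - x * (q * a)) * Z)
    = (q + x) / (x - y * q) * (B * (Z * (P * ((x - y * q) / (x - q\<^sup>2 * a)))) * (q * a))
      - y * q / (x - y * q) * (B * (1 + q * a) * (Z * (P * ((x - y * q) / (x - q\<^sup>2 * a)))) * (q * a)\<^sup>2)"
proof -
  \<comment> \<open>As an atom, the factor \<open>x - y * q\<close> cancels against the coefficients
    before anything is multiplied out.\<close>
  define d where "d = x - y * q"
  have "d \<noteq> 0"
    using assms(1) by (simp add: d_def)
  then have rhs: "s / d * (C * (Z * (P * (d / e))) * t) = s * C * Z * P * t / e" for s C e t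
    by simp
  have lhs: "P * (q * a) / ((x - q\<^sup>2 * a) * (1 - q * a)) * (B * (1 - q * a) * (q - x * (q * a)) * Z)
    = P * (q * a) * B * (q - x * (q * a)) * Z / (x - q\<^sup>2 * a)"
    using assms(3) by simp
  show ?thesis
    unfolding lhs d_def[symmetric] rhs using assms(2) by (simp add: divide_simps) algebra
qed

text \<open>The argument is purely algebraic, so it is carried out over any field; the assumption on
  \<open>q\<close> keeps the denominators of the q-binomials nonzero.\<close>

lemma q_identity:
  fixes q x y :: "'a :: field"
  assumes q: "\<And>k. q ^ Suc k \<noteq> 1"
    and "x \<noteq> 0"
    and "x \<noteq> y * q"
    and "q_pochhammer x q m \<noteq> 0"
    and "q_pochhammer (q\<^sup>2 / x) q m \<noteq> 0"
  shows "q_pochhammer (y * q\<^sup>2 / x) q m / q_pochhammer (q\<^sup>2 / x) q m *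
      (\<Sum>k=0..m. q_binomial q (m + k) k * (q_pochhammer y q k / q_pochhammer x q k) * q ^ k)
    = 1
      + (q + x) / (x - y * q) *
        (\<Sum>k=1..m. q_binomial q (2 * k - 1) k *
          (q_pochhammer y q k * q_pochhammer (y * q / x) q k /
            (q_pochhammer x q k * q_pochhammer (q\<^sup>2 / x) q k)) * q ^ k)
      - y * q / (x - y * q) *
        (\<Sum>k=1..m. q_binomial q (2 * k) k *
          (q_pochhammer y q k * q_pochhammer (y * q / x) q k /
            (q_pochhammer x q k * q_pochhammer (q\<^sup>2 / x) q k)) * q ^ (2 * k))"
  using assms(4,5)
proof (induction m)
  case 0
  then show ?case by (simp add: q_binomial_0[OF q])
next
  case (Suc m)
  let ?P = "q_pochhammer (y * q\<^sup>2 / x) q m / q_pochhammer (q\<^sup>2 / x) q m"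
  let ?Z = "q_pochhammer y q (Suc m) / q_pochhammer x q (Suc m)"
  let ?B = "q_binomial q (m + Suc m) (Suc m)"
  let ?f = "\<lambda>n k. q_binomial q (n + k) k * (q_pochhammer y q k / q_pochhammer x q k) * q ^ k"
  have xm: "q_pochhammer x q m \<noteq> 0" and qxm: "q_pochhammer (q\<^sup>2 / x) q m \<noteq> 0"
    and "1 - q\<^sup>2 / x * q ^ m \<noteq> 0"
    using Suc.prems by (auto simp: q_pochhammer_Suc)
  then have d: "x - q\<^sup>2 * q ^ m \<noteq> 0"
    using \<open>x \<noteq> 0\<close> by (auto simp: field_simps)
  have qm: "1 - q * q ^ m \<noteq> 0"
    using q[of m] by auto
  have d': "x - y * q \<noteq> 0"
    using \<open>x \<noteq> y * q\<close> by simp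
  have factor: "1 - t / x * q ^ m = (x - t * q ^ m) / x" for t
    using \<open>x \<noteq> 0\<close> by (simp add: field_simps)
  have P: "q_pochhammer (y * q\<^sup>2 / x) q (Suc m) / q_pochhammer (q\<^sup>2 / x) q (Suc m)
      = ?P * ((x - y * q\<^sup>2 * q ^ m) / (x - q\<^sup>2 * q ^ m))"
    unfolding q_pochhammer_Suc factor using \<open>x \<noteq> 0\<close> by simp
  \<comment> \<open>Splitting off the first factor instead of the last turns base y q / x into y q^2
    / x, the base in the prefactor \<open>?P\<close>.\<close>
  have "q_pochhammer (y * q / x) q (Suc m) = (x - y * q) / x * q_pochhammer (y * q\<^sup>2 / x) q m"
    unfolding q_pochhammer_Suc_shift using \<open>x \<noteq> 0\<close> by (simp add: field_simps power2_eq_square)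
  then have R: "q_pochhammer y q (Suc m) * q_pochhammer (y * q / x) q (Suc m) /
        (q_pochhammer x q (Suc m) * q_pochhammer (q\<^sup>2 / x) q (Suc m))
      = ?Z * (?P * ((x - y * q) / (x - q\<^sup>2 * q ^ m)))"
    unfolding q_pochhammer_Suc[of "q\<^sup>2 / x"] factor using \<open>x \<noteq> 0\<close> by simp
  \<comment> \<open>Both q-binomials on the right are thus multiples of \<open>?B\<close>: the one
    with upper entry 2m+1 is \<open>?B\<close> itself, the central one gains 1 + q^(m+1).\<close>
  have "q_binomial q (Suc m + Suc m) (Suc m)
      = ?B * ((1 - (q * q ^ m)\<^sup>2) / (1 - q * q ^ m))"
    unfolding q_binomial_add_Suc_left
    by (simp add: power_add power2_eq_square ac_simps)
  also have "(1 - (q * q ^ m)\<^sup>2) / (1 - q * q ^ m) = 1 + q * q ^ m"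
    using qm by (simp add: divide_simps) algebra
  finally have B: "q_binomial q (Suc m + Suc m) (Suc m) = ?B * (1 + q * q ^ m)" .
  have ivl: "sum g {1..Suc m} = sum g {1..m} + g (Suc m)" for g :: "nat \<Rightarrow> 'a"
    by simp
  have idx: "2 * Suc m = Suc m + Suc m" "Suc m + Suc m - 1 = m + Suc m"
    by simp_all
  have pw: "q ^ (Suc m + Suc m) = (q * q ^ m)\<^sup>2"
    by (simp add: power_add power2_eq_square)
  have telescope: "a + b = c + (b + f)" if "a - c = f" for a b c f :: 'a
    using that by (simp add: algebra_simps)
  have "?P * ((x - y * q\<^sup>2 * q ^ m) / (x - q\<^sup>2 * q ^ m)) * (\<Sum>k=0..m. ?f (Suc m) k)
      - ?P * (\<Sum>k=0..m. ?f m k)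
    = ?P * (q * q ^ m) / ((x - q\<^sup>2 * q ^ m) * (1 - q * q ^ m)) *
        (?B * (1 - q * q ^ m) * (q - x * (q * q ^ m)) * ?Z)"
    using gosper_sum[OF q Suc.prems(1) d, of ?P y]
    by (simp only: lessThan_Suc_atMost atMost_atLeast0 power_Suc)
  \<comment> \<open>The telescoped sum stops at k = m; the new top term k = m+1 is split off and
    joins G(m+1).\<close>
  then have "q_pochhammer (y * q\<^sup>2 / x) q (Suc m) / q_pochhammer (q\<^sup>2 / x) q (Suc m) *
        (\<Sum>k=0..Suc m. ?f (Suc m) k)
    = ?P * (\<Sum>k=0..m. ?f m k)
      + (?P * ((x - y * q\<^sup>2 * q ^ m) / (x - q\<^sup>2 * q ^ m)) *
          (?B * (1 + q * q ^ m) * ?Z * (q * q ^ m))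
        + ?P * (q * q ^ m) / ((x - q\<^sup>2 * q ^ m) * (1 - q * q ^ m)) *
          (?B * (1 - q * q ^ m) * (q - x * (q * q ^ m)) * ?Z))"
    unfolding P sum.atLeast0_atMost_Suc distrib_left B power_Suc by (rule telescope)
  also note summand_step[OF d' d qm]
  also note Suc.IH[OF xm qxm]
  finally show ?case
    unfolding ivl idx B R pw power_Suc distrib_left
    by (simp only: algebra_simps)
qed

theorem theorem3p6:
  fixes q x y :: complex and m :: nat
  assumes "norm q < 1"
    and "x \<noteq> 0"
    and "x \<noteq> y * q"
    and "q_pochhammer x q m \<noteq> 0"
    and "q_pochhammer (q\<^sup>2 / x) q m \<noteq> 0"
  shows "q_pochhammer (y * q\<^sup>2 / x) q m / q_pochhammer (q\<^sup>2 / x) q m *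
      (\<Sum>k=0..m. q_binomial q (m + k) k * (q_pochhammer y q k / q_pochhammer x q k) * q ^ k)
    = 1
      + (q + x) / (x - y * q) *
        (\<Sum>k=1..m. q_binomial q (2 * k - 1) k *
          (q_pochhammer y q k * q_pochhammer (y * q / x) q k /
            (q_pochhammer x q k * q_pochhammer (q\<^sup>2 / x) q k)) * q ^ k)
      - y * q / (x - y * q) *
        (\<Sum>k=1..m. q_binomial q (2 * k) k *
          (q_pochhammer y q k * q_pochhammer (y * q / x) q k /
            (q_pochhammer x q k * q_pochhammer (q\<^sup>2 / x) q k)) * q ^ (2 * k))"
proof (rule q_identity)
  show "q ^ Suc k \<noteq> 1" for k
  proof
    assume "q ^ Suc k = 1"
    then have "norm q ^ Suc k = 1"
      by (metis norm_one norm_power)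
    moreover have "norm q ^ Suc k < 1"
      using \<open>norm q < 1\<close> by (subst power_less_one_iff) auto
    ultimately show False
      by simp
  qed
qed (use assms in auto)

end
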